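(* Let $d\ge1$ be an integer and let $\Omega\subseteq\mathbb{R}^d$ be locally compact. For a typical function $f\in C(\Omega)$ there is a set $A\subseteq\Omega$ such that (i) $A$ is microscopic in $\mathbb{R}^d$; (ii) the set $\{y\in\mathbb{R}:f^{-1}(y)\nsubseteq A\}$ is microscopic in $\mathbb{R}$.
   Context: $C(\Omega)$ is the space of continuous real functions on $\Omega$ with the compact-open topology. "For a typical $f$ ... holds" means: there is a comeager set $\mathcal{F}\subseteq C(\Omega)$ such that every $f\in\mathcal{F}$ has the property. A box in $\mathbb{R}^m$ is a cartesian product of $m$ compact intervals in $\mathbb{R}$; $\lambda_m$ is Lebesgue measure in $\mathbb{R}^m$. A set $X\subseteq\mathbb{R}^m$ is microscopic in $\mathbb{R}^m$ if for each $\varepsilon>0$ there is a sequence of boxes $B_1,B_2,\dots$ in $\mathbb{R}^m$ covering $X$ such that $\lambda_m(B_n)\le\varepsilon^n$ for all $n\ge1$. *)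

theory Defs
  imports "HOL-Analysis.Analysis"
begin

(* Functions are taken to be undefined off topspace X, so that a point of the space is
   determined by its values on topspace X. *)
definition continuous_maps :: "'a topology \<Rightarrow> 'b topology \<Rightarrow> ('a \<Rightarrow> 'b) set" where
  "continuous_maps X Y = {f \<in> extensional (topspace X). continuous_map X Y f}"

definition compact_open_topology :: "'a topology \<Rightarrow> 'b topology \<Rightarrow> ('a \<Rightarrow> 'b) topology" where
  "compact_open_topology X Y =
     topology_generated_by
       {{f \<in> continuous_maps X Y. f ` K \<subseteq> U} | K U. compactin X K \<and> openin Y U}"

lemma topspace_compact_open_topology [simp]:
  "topspace (compact_open_topology X Y) = continuous_maps X Y"
proof
  show "topspace (compact_open_topology X Y) \<subseteq> continuous_maps X Y"
    by (auto simp: compact_open_topology_def topology_generated_by_topspace)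
  have "continuous_maps X Y = {f \<in> continuous_maps X Y. f ` {} \<subseteq> {}}"
    by simp
  moreover have "compactin X {}" "openin Y {}"
    by auto
  ultimately show "continuous_maps X Y \<subseteq> topspace (compact_open_topology X Y)"
    unfolding compact_open_topology_def topology_generated_by_topspace by blast
qed

abbreviation continuous_function_space :: "'a::topological_space set \<Rightarrow> ('a \<Rightarrow> real) topology" where
  "continuous_function_space \<Omega> \<equiv> compact_open_topology (top_of_set \<Omega>) euclideanreal"

definition nowhere_dense_in :: "'a topology \<Rightarrow> 'a set \<Rightarrow> bool" where
  "nowhere_dense_in X S \<longleftrightarrow> S \<subseteq> topspace X \<and> X interior_of (X closure_of S) = {}"

definition meager_in :: "'a topology \<Rightarrow> 'a set \<Rightarrow> bool" where
  "meager_in X S \<longleftrightarrow>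
     (\<exists>N :: nat \<Rightarrow> 'a set. (\<forall>n. nowhere_dense_in X (N n)) \<and> S = (\<Union>n. N n))"

definition comeager_in :: "'a topology \<Rightarrow> 'a set \<Rightarrow> bool" where
  "comeager_in X S \<longleftrightarrow> S \<subseteq> topspace X \<and> meager_in X (topspace X - S)"

definition typical :: "'a topology \<Rightarrow> ('a \<Rightarrow> bool) \<Rightarrow> bool" where
  "typical X P \<longleftrightarrow> (\<exists>F. comeager_in X F \<and> (\<forall>f\<in>F. P f))"

(* cbox a b is the product of the intervals [a \<bullet> i, b \<bullet> i], i \<in> Basis. Degenerate intervals
   are allowed, empty ones are not. *)
definition is_compact_box :: "'a::euclidean_space set \<Rightarrow> bool" where
  "is_compact_box B \<longleftrightarrow> (\<exists>a b. (\<forall>i\<in>Basis. a \<bullet> i \<le> b \<bullet> i) \<and> B = cbox a b)"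

definition microscopic :: "'a::euclidean_space set \<Rightarrow> bool" where
  "microscopic X \<longleftrightarrow>
     (\<forall>\<epsilon>>0. \<exists>B :: nat \<Rightarrow> 'a set.
        (\<forall>n\<ge>1. is_compact_box (B n) \<and> measure lebesgue (B n) \<le> \<epsilon> ^ n) \<and> X \<subseteq> (\<Union>n\<in>{1..}. B n))"

end

theory Submission
  imports Defs
begin

text \<open>
  On a compact set \<open>K\<close>, a continuous function can be changed by arbitrarily little so that off thin
  neighbourhoods of the hyperplanes of a fine cubical grid it takes only finitely many values. The
  number of grid hyperplanes meeting \<open>K\<close> is fixed before the thickness of the neighbourhoods, and
  the number of values before the length of the intervals around them; so both can be made as thin
  as any prescribed sequence demands. Hence the functions mapping \<open>K n - U\<close> into \<open>Y\<close> for some thin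
  \<open>U\<close> and \<open>Y\<close> form a dense set, open since \<open>K n - U\<close> is compact and \<open>Y\<close> open. For \<open>f\<close> in
  all these sets, with \<open>K n\<close> increasing to \<open>\<Omega>\<close>, take \<open>A\<close> to be the upper limit of the sets \<open>U n\<close>:
  off \<open>A\<close> the values of \<open>f\<close> lie in the upper limit of the sets \<open>Y n\<close>.
\<close>

section \<open>Thin finite unions of boxes and their upper limits\<close>

text \<open>
  The exponent encodes the pair \<open>(n, i)\<close> injectively, so boxes from different levels can be merged
  into a single sequence without renumbering.
\<close>
definition thin_union :: "nat \<Rightarrow> 'a::euclidean_space set \<Rightarrow> bool" where
  "thin_union n U \<longleftrightarrow>
     (\<exists>m a b. (\<forall>i<m. (\<forall>k\<in>Basis. a i \<bullet> k \<le> b i \<bullet> k) \<and>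
                measure lebesgue (cbox (a i) (b i)) \<le> (1/2) ^ (n * Suc (prod_encode (n, i)))) \<and>
              U = (\<Union>i<m. box (a i) (b i)))"

lemma thin_union_open: "thin_union n U \<Longrightarrow> open U"
  unfolding thin_union_def by (auto intro!: open_UN)

lemma microscopic_limsup_thin_union:
  fixes U :: "nat \<Rightarrow> 'a::euclidean_space set"
  assumes thin: "\<And>n. thin_union n (U n)"
    and X: "\<And>x. x \<in> X \<Longrightarrow> \<exists>\<^sub>\<infinity>n. x \<in> U n"
  shows "microscopic X"
  unfolding microscopic_def
proof (intro allI impI)
  fix \<epsilon> :: real assume "\<epsilon> > 0"
  then obtain N where N: "(1/2) ^ N \<le> \<epsilon>"
    using real_arch_pow_inv[of \<epsilon> "1/2"] by (auto intro: less_imp_le)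
  have "\<forall>n. \<exists>m a b. (\<forall>i<m. (\<forall>k\<in>Basis. a i \<bullet> k \<le> b i \<bullet> k) \<and>
                measure lebesgue (cbox (a i) (b i)) \<le> (1/2) ^ (n * Suc (prod_encode (n, i)))) \<and>
              U n = (\<Union>i<m. box (a i) (b i))"
    using thin unfolding thin_union_def by blast
  then obtain m a b where *: "\<forall>n. (\<forall>i<m n. (\<forall>k\<in>Basis. a n i \<bullet> k \<le> b n i \<bullet> k) \<and>
        measure lebesgue (cbox (a n i) (b n i)) \<le> (1/2) ^ (n * Suc (prod_encode (n, i)))) \<and>
      U n = (\<Union>i<m n. box (a n i) (b n i))"
    unfolding choice_iff by (elim exE)
  have ab: "\<And>n i. i < m n \<Longrightarrow> (\<forall>k\<in>Basis. a n i \<bullet> k \<le> b n i \<bullet> k)"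
    and vol: "\<And>n i. i < m n \<Longrightarrow>
      measure lebesgue (cbox (a n i) (b n i)) \<le> (1/2) ^ (n * Suc (prod_encode (n, i)))"
    and U: "\<And>n. U n = (\<Union>i<m n. box (a n i) (b n i))"
    using * by blast+
  \<comment> \<open>Positions start at 1 but codes at 0, hence \<open>k - 1\<close>. Positions that
    receive no box are filled with the null box \<open>cbox 0 0\<close>, since a box is required at
    every position.\<close>
  define B where "B k = (case prod_decode (k - 1) of (n, i) \<Rightarrow>
      if n \<ge> N \<and> i < m n then cbox (a n i) (b n i) else cbox 0 0)" for k
  have B: "is_compact_box (B k) \<and> measure lebesgue (B k) \<le> \<epsilon> ^ k" if "k \<ge> 1" for k
  proof -
    obtain n i where ni: "prod_decode (k - 1) = (n, i)"
      by fastforce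
    then have k: "k = Suc (prod_encode (n, i))"
      using that by (metis One_nat_def Suc_pred' less_eq_Suc_le prod_decode_inverse)
    show ?thesis
    proof (cases "n \<ge> N \<and> i < m n")
      case True
      have "(1/2::real) ^ n \<le> (1/2) ^ N"
        using True by (intro power_decreasing) auto
      then have "(1/2::real) ^ (n * k) \<le> \<epsilon> ^ k"
        unfolding power_mult using order_trans[OF _ N] by (intro power_mono) auto
      then have "measure lebesgue (cbox (a n i) (b n i)) \<le> \<epsilon> ^ k"
        using True order_trans[OF vol[of i n]] unfolding k by blast
      then show ?thesis
        using True ab[of i n] unfolding is_compact_box_def B_def ni by auto
    next
      case False
      then have "B k = cbox 0 0"
        unfolding B_def ni by auto
      moreover have "is_compact_box (cbox 0 (0::'a))"
        unfolding is_compact_box_def by (intro exI[of _ 0] conjI ballI order_refl refl)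
      ultimately show ?thesis
        using \<open>\<epsilon> > 0\<close> by simp
    qed
  qed
  have "X \<subseteq> (\<Union>n\<in>{1..}. B n)"
  proof
    fix x assume "x \<in> X"
    then obtain n where "n \<ge> N" "x \<in> U n"
      using X unfolding INFM_nat_le by blast
    then obtain i where i: "i < m n" "x \<in> box (a n i) (b n i)"
      using U by auto
    then have "x \<in> B (Suc (prod_encode (n, i)))"
      using \<open>n \<ge> N\<close> box_subset_cbox by (auto simp: B_def)
    then show "x \<in> (\<Union>n\<in>{1..}. B n)"
      by (intro UN_I[of "Suc (prod_encode (n, i))"]) auto
  qed
  then show "\<exists>B. (\<forall>n\<ge>1. is_compact_box (B n) \<and> measure lebesgue (B n) \<le> \<epsilon> ^ n) \<and> X \<subseteq> (\<Union>n\<in>{1..}. B n)"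
    using B by blast
qed

section \<open>Flat boxes and their thin neighbourhoods\<close>

text \<open>The pair stands for the corners of a closed box with a side of length 0. This covers
  both faces of a grid and single points.\<close>

definition flat_box :: "'a::euclidean_space \<times> 'a \<Rightarrow> bool" where
  "flat_box p \<longleftrightarrow> (\<forall>k\<in>Basis. fst p \<bullet> k \<le> snd p \<bullet> k) \<and> (\<exists>k\<in>Basis. fst p \<bullet> k = snd p \<bullet> k)"

text \<open>Moving every face outwards by \<open>t\<close> gives a box whose volume is a polynomial
  in \<open>t\<close>. The flat side contributes a factor that vanishes at 0, so a small positive
  \<open>t\<close> brings the volume below \<open>e\<close>.\<close>

lemma flat_box_enlarge:
  fixes a b :: "'a::euclidean_space"
  assumes "flat_box (a, b)" and "e > 0"
  obtains a' b' where "\<forall>k\<in>Basis. a' \<bullet> k \<le> b' \<bullet> k" "measure lebesgue (cbox a' b') \<le> e"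
    "cbox a b \<subseteq> box a' b'"
proof -
  have ab: "a \<bullet> k \<le> b \<bullet> k" if "k \<in> Basis" for k
    using assms that by (auto simp: flat_box_def)
  obtain k0 where k0: "k0 \<in> Basis" "a \<bullet> k0 = b \<bullet> k0"
    using assms by (auto simp: flat_box_def)
  have "((\<lambda>t. \<Prod>k\<in>Basis. b \<bullet> k - a \<bullet> k + 2 * t) \<longlongrightarrow> (\<Prod>k\<in>Basis. b \<bullet> k - a \<bullet> k + 2 * 0)) (at_right 0)"
    by (intro tendsto_intros)
  moreover have "(\<Prod>k\<in>Basis. b \<bullet> k - a \<bullet> k + 2 * 0) = 0"
    using k0 by (intro prod_zero bexI[of _ k0]) auto
  ultimately have "\<forall>\<^sub>F t in at_right 0. (\<Prod>k\<in>Basis. b \<bullet> k - a \<bullet> k + 2 * t) < e"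
    using order_tendstoD(2) \<open>e > 0\<close> by metis
  moreover have "\<forall>\<^sub>F t in at_right (0::real). t > 0"
    by (rule eventually_at_right_less)
  ultimately have "\<forall>\<^sub>F t in at_right 0. (\<Prod>k\<in>Basis. b \<bullet> k - a \<bullet> k + 2 * t) < e \<and> t > 0"
    by (rule eventually_conj)
  then obtain t where t: "t > 0" "(\<Prod>k\<in>Basis. b \<bullet> k - a \<bullet> k + 2 * t) < e"
    using eventually_happens'[OF trivial_limit_at_right_real] by blast
  let ?a = "a - t *\<^sub>R One" and ?b = "b + t *\<^sub>R One"
  have le: "?a \<bullet> k \<le> ?b \<bullet> k" if "k \<in> Basis" for k
    using ab[OF that] t that by (simp add: inner_diff_left inner_add_left)
  have "measure lebesgue (cbox ?a ?b) = (\<Prod>k\<in>Basis. ?b \<bullet> k - ?a \<bullet> k)"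
    using le by (simp add: content_cbox_cases)
  also have "\<dots> = (\<Prod>k\<in>Basis. b \<bullet> k - a \<bullet> k + 2 * t)"
    by (intro prod.cong) (auto simp: inner_diff_left inner_add_left)
  finally have "measure lebesgue (cbox ?a ?b) \<le> e"
    using t by simp
  moreover have "cbox a b \<subseteq> box ?a ?b"
    using t by (force simp: mem_box inner_diff_left inner_add_left)
  ultimately show thesis
    using le that by blast
qed

text \<open>The volume allowed in a thin union depends on the index of the box. Listing the finite
  set fixes the indices first; flatness then allows each box to be enlarged within its own
  bound.\<close>

lemma flat_boxes_in_thin_union:
  fixes P :: "('a::euclidean_space \<times> 'a) set"
  assumes "finite P" and flat: "\<And>p. p \<in> P \<Longrightarrow> flat_box p"
  obtains U where "thin_union n U" "(\<Union>(a, b)\<in>P. cbox a b) \<subseteq> U"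
proof -
  obtain xs where xs: "set xs = P"
    using \<open>finite P\<close> finite_list by blast
  have "\<exists>a' b'. (\<forall>k\<in>Basis. a' \<bullet> k \<le> b' \<bullet> k) \<and>
      measure lebesgue (cbox a' b') \<le> (1/2) ^ (n * Suc (prod_encode (n, i))) \<and>
      cbox (fst (xs ! i)) (snd (xs ! i)) \<subseteq> box a' b'" if "i < length xs" for i
  proof -
    have "flat_box (fst (xs ! i), snd (xs ! i))"
      using flat xs nth_mem[OF that] by simp
    then show ?thesis
      by (rule flat_box_enlarge[where e = "(1/2) ^ (n * Suc (prod_encode (n, i)))"]) (simp, blast)
  qed
  then obtain a b where
    ab: "\<And>i. i < length xs \<Longrightarrow> (\<forall>k\<in>Basis. a i \<bullet> k \<le> b i \<bullet> k) \<and>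
      measure lebesgue (cbox (a i) (b i)) \<le> (1/2) ^ (n * Suc (prod_encode (n, i))) \<and>
      cbox (fst (xs ! i)) (snd (xs ! i)) \<subseteq> box (a i) (b i)"
    by metis
  show thesis
  proof
    show "thin_union n (\<Union>i<length xs. box (a i) (b i))"
      unfolding thin_union_def using ab by blast
    show "(\<Union>(a, b)\<in>P. cbox a b) \<subseteq> (\<Union>i<length xs. box (a i) (b i))"
    proof clarify
      fix x c d assume "x \<in> cbox c d" "(c, d) \<in> P"
      moreover then obtain i where "i < length xs" "xs ! i = (c, d)"
        using xs by (metis in_set_conv_nth)
      ultimately show "x \<in> (\<Union>i<length xs. box (a i) (b i))"
        using ab[of i] by auto
    qed
  qed
qed

lemma finite_in_thin_union:
  fixes S :: "'a::euclidean_space set"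
  assumes "finite S"
  obtains Y where "thin_union n Y" "S \<subseteq> Y"
proof (rule flat_boxes_in_thin_union[of "(\<lambda>x. (x, x)) ` S" n])
  show "flat_box p" if "p \<in> (\<lambda>x. (x, x)) ` S" for p
    using that by (auto simp: flat_box_def ex_in_conv)
qed (use assms that in auto)

section \<open>Fine cubical grids on compact sets\<close>

text \<open>The map \<open>p\<close> sends a point to the integer vector that indexes its grid cell.
  It can jump only where a coordinate crosses a grid hyperplane, and \<open>P\<close> consists of
  pieces of hyperplanes that contain all such points of \<open>K\<close>.\<close>

lemma compact_fine_grid:
  fixes K :: "'a::euclidean_space set"
  assumes "compact K" and "r > 0"
  obtains P and p :: "'a \<Rightarrow> 'a" where
    "finite P" "\<And>q. q \<in> P \<Longrightarrow> flat_box q"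
    "continuous_on (K - (\<Union>(a, b)\<in>P. cbox a b)) p" "finite (p ` K)"
    "\<And>x y. p x = p y \<Longrightarrow> dist x y < r"
proof -
  obtain R where R: "\<And>x. x \<in> K \<Longrightarrow> norm x \<le> R" "R > 0"
    using compact_imp_bounded[OF \<open>compact K\<close>] by (meson bounded_pos)
  \<comment> \<open>Cells have side \<open>1 / c = r / DIM('a)\<close>, so that the coordinate
    differences within a cell sum to less than \<open>r\<close>.\<close>
  define c where "c = DIM('a) / r"
  have c: "c > 0"
    using \<open>r > 0\<close> by (simp add: c_def)
  define J where "J = {\<lfloor>- (c * R)\<rfloor>..\<lfloor>c * R\<rfloor>}"
  have xR: "\<bar>x \<bullet> k\<bar> \<le> R" if "x \<in> K" "k \<in> Basis" for x k
    using R(1)[OF that(1)] Basis_le_norm[OF that(2), of x] by linarith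
  have J: "\<lfloor>c * (x \<bullet> k)\<rfloor> \<in> J" if "x \<in> K" "k \<in> Basis" for x k
  proof -
    have "c * (x \<bullet> k) \<le> c * R" "c * (- R) \<le> c * (x \<bullet> k)"
      using xR[OF that] c by (intro mult_left_mono; simp)+
    then show ?thesis
      unfolding J_def by (auto intro!: floor_mono)
  qed
  define p :: "'a \<Rightarrow> 'a" where "p x = (\<Sum>k\<in>Basis. of_int \<lfloor>c * (x \<bullet> k)\<rfloor> *\<^sub>R k)" for x
  \<comment> \<open>\<open>lo i j\<close> and \<open>hi i j\<close> are the corners of the piece of
    the hyperplane with \<open>i\<close>-th coordinate \<open>j / c\<close> whose other coordinates
    range over \<open>[-R, R]\<close>; every point of \<open>K\<close> on that hyperplane lies in
    this piece.\<close>
  define lo :: "'a \<Rightarrow> int \<Rightarrow> 'a" where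
    "lo i j = (\<Sum>k\<in>Basis. (if k = i then of_int j / c else - R) *\<^sub>R k)" for i j
  define hi :: "'a \<Rightarrow> int \<Rightarrow> 'a" where
    "hi i j = (\<Sum>k\<in>Basis. (if k = i then of_int j / c else R) *\<^sub>R k)" for i j
  define P where "P = (\<lambda>(i, j). (lo i j, hi i j)) ` (Basis \<times> J)"
  have lo: "lo i j \<bullet> k = (if k = i then of_int j / c else - R)" if "k \<in> Basis" for i j k
    using that by (simp add: lo_def)
  have hi: "hi i j \<bullet> k = (if k = i then of_int j / c else R)" if "k \<in> Basis" for i j k
    using that by (simp add: hi_def)
  \<comment> \<open>Off the boxes of \<open>P\<close> no scaled coordinate is an integer, and away
    from the integers the floor function is continuous.\<close>
  have nonint: "c * (x \<bullet> i) \<notin> \<int>" if x: "x \<in> K - (\<Union>(a, b)\<in>P. cbox a b)" and i: "i \<in> Basis" for x i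
  proof
    assume "c * (x \<bullet> i) \<in> \<int>"
    then obtain j where j: "c * (x \<bullet> i) = of_int j"
      by (auto elim: Ints_cases)
    then have "j \<in> J"
      using J[of x i] x i by simp
    then have "(lo i j, hi i j) \<in> P"
      using i by (auto simp: P_def)
    moreover have "- R \<le> x \<bullet> k" "x \<bullet> k \<le> R" if "k \<in> Basis" for k
      using xR[of x k] x that by auto
    then have "x \<in> cbox (lo i j) (hi i j)"
      using j c by (auto simp: mem_box lo hi field_simps)
    ultimately show False
      using x by auto
  qed
  show thesis
  proof (rule that[of P p])
    show "finite P"
      by (simp add: P_def J_def)
    show "flat_box q" if "q \<in> P" for q
      using that R(2) by (auto simp: P_def flat_box_def lo hi)
    show "continuous_on (K - (\<Union>(a, b)\<in>P. cbox a b)) p"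
      unfolding p_def
    proof (intro continuous_on_sum continuous_on_scaleR continuous_on_const)
      fix k :: 'a assume "k \<in> Basis"
      then show "continuous_on (K - (\<Union>(a, b)\<in>P. cbox a b)) (\<lambda>x. real_of_int \<lfloor>c * (x \<bullet> k)\<rfloor>)"
        using nonint by (intro continuous_on_compose2[OF continuous_on_of_int_floor]
            continuous_intros) auto
    qed
    show "finite (p ` K)"
    proof (rule finite_subset)
      show "p ` K \<subseteq> (\<lambda>g. \<Sum>k\<in>Basis. of_int (g k) *\<^sub>R k) ` (Basis \<rightarrow>\<^sub>E J)"
      proof
        fix z assume "z \<in> p ` K"
        then obtain x where x: "x \<in> K" "z = p x" by auto
        then show "z \<in> (\<lambda>g. \<Sum>k\<in>Basis. of_int (g k) *\<^sub>R k) ` (Basis \<rightarrow>\<^sub>E J)"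
          using J by (intro image_eqI[of _ _ "restrict (\<lambda>k. \<lfloor>c * (x \<bullet> k)\<rfloor>) Basis"])
            (auto simp: p_def)
      qed
      show "finite ((\<lambda>g. \<Sum>k\<in>Basis. of_int (g k) *\<^sub>R k :: 'a) ` (Basis \<rightarrow>\<^sub>E J))"
        by (intro finite_imageI finite_PiE) (auto simp: J_def)
    qed
    show "dist x y < r" if "p x = p y" for x y
    proof -
      have *: "\<bar>(x - y) \<bullet> k\<bar> < 1 / c" if k: "k \<in> Basis" for k
      proof -
        have "p x \<bullet> k = p y \<bullet> k"
          using \<open>p x = p y\<close> by simp
        then have "\<lfloor>c * (x \<bullet> k)\<rfloor> = \<lfloor>c * (y \<bullet> k)\<rfloor>"
          using k by (simp add: p_def)
        then have "\<bar>c * (x \<bullet> k) - c * (y \<bullet> k)\<bar> < 1"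
          by linarith
        then have "c * \<bar>(x - y) \<bullet> k\<bar> < 1"
          using c by (simp add: abs_mult inner_diff_left flip: right_diff_distrib)
        then show ?thesis
          using c by (simp add: field_simps)
      qed
      have "dist x y \<le> (\<Sum>k\<in>Basis. \<bar>(x - y) \<bullet> k\<bar>)"
        unfolding dist_norm by (rule norm_le_l1)
      also have "\<dots> < (\<Sum>k\<in>(Basis::'a set). 1 / c)"
        using * by (intro sum_strict_mono) auto
      also have "\<dots> = r"
        by (simp add: c_def)
      finally show ?thesis .
    qed
  qed
qed

section \<open>Compact exhaustion and the compact-open topology\<close>

text \<open>A locally compact subset of a Euclidean space is the intersection of a closed set with
  an open one. Compact sets exhausting the open set remain compact when cut with the closed
  set.\<close>

lemma locally_compact_exhaustion:
  fixes \<Omega> :: "'a::euclidean_space set"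
  assumes "locally compact \<Omega>"
  obtains K :: "nat \<Rightarrow> 'a set" where "\<And>n. compact (K n)" "incseq K" "(\<Union>n. K n) = \<Omega>"
proof -
  obtain T V where TV: "closed T" "open V" "\<Omega> = T \<inter> V"
    using assms unfolding locally_compact_closed_Int_open by blast
  obtain C where C: "\<And>n. compact (C n)" "\<And>n. C n \<subseteq> interior (C (Suc n))" "\<Union>(range C) = V"
    by (rule open_Union_compact_subsets[OF \<open>open V\<close>]) blast
  have "C n \<subseteq> C (Suc n)" for n
    using C(2) interior_subset by blast
  then have "incseq (\<lambda>n. T \<inter> C n)"
    by (intro incseq_SucI) blast
  then show thesis
    using TV C by (intro that[of "\<lambda>n. T \<inter> C n"]) (auto intro: closed_Int_compact)
qed

lemma compact_open_topology_subbasic: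
  assumes "compactin X K" "openin Y U"
  shows "openin (compact_open_topology X Y) {f \<in> continuous_maps X Y. f ` K \<subseteq> U}"
  unfolding compact_open_topology_def using assms by (intro topology_generated_by_Basis) blast

text \<open>This reduces density to uniform approximation on a compact set. The induction follows
  the generation of open sets: a finite intersection takes the union of the compact sets and the
  smaller radius, a union keeps the data of one member.\<close>

lemma compact_open_topology_uniform_nbhd:
  fixes \<Omega> :: "'a::t2_space set"
  assumes "openin (continuous_function_space \<Omega>) W" and "f \<in> W"
  shows "\<exists>K \<delta>. compact K \<and> K \<subseteq> \<Omega> \<and> \<delta> > 0 \<and>
    (\<forall>g \<in> continuous_maps (top_of_set \<Omega>) euclideanreal. (\<forall>x\<in>K. dist (g x) (f x) < \<delta>) \<longrightarrow> g \<in> W)"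
proof -
  let ?C = "continuous_maps (top_of_set \<Omega>) euclideanreal"
  have "generate_topology_on {{f \<in> ?C. f ` K \<subseteq> U} |K U.
      compactin (top_of_set \<Omega>) K \<and> openin euclideanreal U} W"
    using assms(1) unfolding compact_open_topology_def by (rule openin_topology_generated_by)
  then show ?thesis
    using assms(2)
  proof (induction rule: generate_topology_on.induct)
    case Empty
    then show ?case by simp
  next
    case (Int a b)
    obtain K1 d1 where 1: "compact K1" "K1 \<subseteq> \<Omega>" "d1 > 0"
      "\<forall>g \<in> ?C. (\<forall>x\<in>K1. dist (g x) (f x) < d1) \<longrightarrow> g \<in> a"
      using Int.IH(1) Int.prems by blast
    obtain K2 d2 where 2: "compact K2" "K2 \<subseteq> \<Omega>" "d2 > 0"
      "\<forall>g \<in> ?C. (\<forall>x\<in>K2. dist (g x) (f x) < d2) \<longrightarrow> g \<in> b"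
      using Int.IH(2) Int.prems by blast
    show ?case
      using 1 2 by (intro exI[of _ "K1 \<union> K2"] exI[of _ "min d1 d2"]) auto
  next
    case (UN \<W>)
    then obtain w where w: "w \<in> \<W>" "f \<in> w"
      by blast
    show ?case
      using UN.IH[OF w] w(1) by blast
  next
    case (Basis s)
    then obtain K U where KU: "s = {f \<in> ?C. f ` K \<subseteq> U}" "compact K" "K \<subseteq> \<Omega>" "open U"
      by (auto simp: compactin_subtopology)
    then have f: "continuous_on \<Omega> f" "f ` K \<subseteq> U"
      using Basis by (auto simp: continuous_maps_def)
    then have "compact (f ` K)"
      using KU continuous_on_subset compact_continuous_image by blast
    then obtain e where e: "e > 0" "(\<Union>x\<in>f ` K. ball x e) \<subseteq> U"
      using compact_subset_open_imp_ball_epsilon_subset[OF _ \<open>open U\<close> f(2)] by blast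
    have "g \<in> s" if "g \<in> ?C" "\<forall>x\<in>K. dist (g x) (f x) < e" for g
      using that e(2) by (force simp: KU(1) dist_commute)
    then show ?case
      using KU e(1) by blast
  qed
qed

section \<open>Approximation by functions with thin image off a thin set\<close>

text \<open>On \<open>K - U\<close> the function \<open>f\<close> is replaced by a step function
  constant on grid cells, which is continuous there because \<open>U\<close> swallows the cell
  boundaries. The correction is then extended to all of \<Omega> without increasing its
  bound.\<close>

lemma thin_image_approximation:
  fixes \<Omega> :: "'a::euclidean_space set"
  assumes f: "continuous_on \<Omega> f" and K: "compact K" "K \<subseteq> \<Omega>" and "\<delta> > 0"
  obtains g :: "'a \<Rightarrow> real" and U Y where "continuous_on \<Omega> g" "\<And>x. x \<in> \<Omega> \<Longrightarrow> dist (g x) (f x) < \<delta>"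
    "thin_union n U" "thin_union n Y" "g ` (K - U) \<subseteq> Y"
proof -
  have "uniformly_continuous_on K f"
    using K f continuous_on_subset compact_uniformly_continuous by blast
  then obtain r where r: "r > 0"
    "\<And>x y. x \<in> K \<Longrightarrow> y \<in> K \<Longrightarrow> dist x y < r \<Longrightarrow> dist (f x) (f y) < \<delta> / 2"
    using \<open>\<delta> > 0\<close> unfolding uniformly_continuous_on_def by (metis half_gt_zero)
  obtain P and p :: "'a \<Rightarrow> 'a" where P: "finite P" "\<And>q. q \<in> P \<Longrightarrow> flat_box q"
    and p: "continuous_on (K - (\<Union>(a, b)\<in>P. cbox a b)) p" "finite (p ` K)"
      "\<And>x y. p x = p y \<Longrightarrow> dist x y < r"
    using compact_fine_grid[OF K(1) r(1)] by metis
  obtain U where U: "thin_union n U" "(\<Union>(a, b)\<in>P. cbox a b) \<subseteq> U"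
    using flat_boxes_in_thin_union[of P n] P by blast
  \<comment> \<open>\<open>v z\<close> is the value of \<open>f\<close> at some sample point of
    \<open>K\<close> in the cell with index \<open>z\<close>. Points of one cell are less than
    \<open>r\<close> apart, so this value is within \<open>\<delta> / 2\<close> of \<open>f\<close>
    on the part of the cell in \<open>K\<close>.\<close>
  define v where "v z = f (SOME x. x \<in> K \<and> p x = z)" for z
  have v: "dist (v (p x)) (f x) < \<delta> / 2" if "x \<in> K" for x
    unfolding v_def by (rule someI2[of _ x]) (use that r(2) p(3) in auto)
  obtain Y where Y: "thin_union n Y" "v ` p ` K \<subseteq> Y"
    using finite_in_thin_union[of "v ` p ` K" n] p(2) by blast
  have "compact (K - U)"
    using K(1) thin_union_open[OF U(1)] by (rule compact_diff)
  then have "closedin (top_of_set \<Omega>) (K - U)"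
    using K(2) by (intro closed_subset compact_imp_closed) auto
  moreover have "continuous_on (K - U) (\<lambda>x. v (p x) - f x)"
  proof (intro continuous_intros)
    have "continuous_on (K - U) p"
      using p(1) by (rule continuous_on_subset) (use U(2) in auto)
    then show "continuous_on (K - U) (\<lambda>x. v (p x))"
      using p(2) by (rule_tac continuous_on_compose2[OF continuous_on_finite[of "p ` K" v]]) auto
    show "continuous_on (K - U) f"
      using f by (rule continuous_on_subset) (use K(2) in auto)
  qed
  moreover have "norm (v (p x) - f x) \<le> \<delta> / 2" if "x \<in> K - U" for x
    using v[of x] that by (simp add: dist_norm)
  \<comment> \<open>Tietze's theorem is applied to the difference from \<open>f\<close> and not to
    the step function itself: its bound \<open>\<delta> / 2\<close> then keeps \<open>f + h\<close>
    close to \<open>f\<close> on all of \<Omega>, also outside \<open>K\<close>.\<close>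
  ultimately obtain h where h: "continuous_on \<Omega> h" "\<And>x. x \<in> K - U \<Longrightarrow> h x = v (p x) - f x"
    "\<And>x. x \<in> \<Omega> \<Longrightarrow> norm (h x) \<le> \<delta> / 2"
    using Tietze[of "K - U" "\<lambda>x. v (p x) - f x" \<Omega> "\<delta> / 2"] \<open>\<delta> > 0\<close> by auto
  show thesis
  proof
    show "continuous_on \<Omega> (\<lambda>x. f x + h x)"
      using f h(1) by (intro continuous_intros)
    show "dist (f x + h x) (f x) < \<delta>" if "x \<in> \<Omega>" for x
      using h(3)[OF that] \<open>\<delta> > 0\<close> by (simp add: dist_norm)
    show "(\<lambda>x. f x + h x) ` (K - U) \<subseteq> Y"
      using h(2) Y(2) by auto
  qed fact+
qed

section \<open>Dense open sets of functions\<close>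

text \<open>The complement of a dense open set is closed with empty interior, hence nowhere
  dense.\<close>

lemma comeager_in_INT_open_dense:
  fixes V :: "nat \<Rightarrow> 'a set"
  assumes op: "\<And>n. openin X (V n)"
    and dense: "\<And>n W. openin X W \<Longrightarrow> W \<noteq> {} \<Longrightarrow> W \<inter> V n \<noteq> {}"
  shows "comeager_in X (\<Inter>n. V n)"
proof -
  have "nowhere_dense_in X (topspace X - V n)" for n
  proof -
    have "X closure_of (topspace X - V n) = topspace X - V n"
      using op by (intro closure_of_closedin) auto
    moreover have "X interior_of (topspace X - V n) = {}"
      using dense[of "X interior_of (topspace X - V n)" n] interior_of_subset[of X "topspace X - V n"]
      by auto
    ultimately show ?thesis
      by (simp add: nowhere_dense_in_def)
  qed
  moreover have "topspace X - (\<Inter>n. V n) = (\<Union>n. topspace X - V n)"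
    by auto
  moreover have "(\<Inter>n. V n) \<subseteq> topspace X"
    using openin_subset[OF op] by blast
  ultimately show ?thesis
    unfolding comeager_in_def meager_in_def by (auto intro!: exI[of _ "\<lambda>n. topspace X - V n"])
qed

text \<open>\<open>U\<close> and \<open>Y\<close> may depend on \<open>f\<close>; this makes the set
  a union of subbasic open sets, one for each pair, and leaves room for density.\<close>

definition thin_image_maps :: "'a::euclidean_space set \<Rightarrow> 'a set \<Rightarrow> nat \<Rightarrow> ('a \<Rightarrow> real) set" where
  "thin_image_maps \<Omega> K n = {f \<in> continuous_maps (top_of_set \<Omega>) euclideanreal.
     \<exists>U Y. thin_union n U \<and> thin_union n Y \<and> f ` (K - U) \<subseteq> Y}"

lemma openin_thin_image_maps:
  assumes "compact K" "K \<subseteq> \<Omega>"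
  shows "openin (continuous_function_space \<Omega>) (thin_image_maps \<Omega> K n)"
proof -
  have "openin (continuous_function_space \<Omega>)
      {f \<in> continuous_maps (top_of_set \<Omega>) euclideanreal. f ` (K - U) \<subseteq> Y}"
    if "thin_union n U" "thin_union n Y" for U Y
    using assms thin_union_open[OF that(1)] thin_union_open[OF that(2)]
    by (intro compact_open_topology_subbasic) (auto simp: compactin_subtopology compact_diff)
  then have "openin (continuous_function_space \<Omega>)
      (\<Union>(U, Y)\<in>{(U, Y). thin_union n U \<and> thin_union n Y}.
        {f \<in> continuous_maps (top_of_set \<Omega>) euclideanreal. f ` (K - U) \<subseteq> Y})"
    by (intro openin_clauses(3)) auto
  also have "(\<Union>(U, Y)\<in>{(U, Y). thin_union n U \<and> thin_union n Y}.
        {f \<in> continuous_maps (top_of_set \<Omega>) euclideanreal. f ` (K - U) \<subseteq> Y}) = thin_image_maps \<Omega> K n"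
    by (auto simp: thin_image_maps_def)
  finally show ?thesis .
qed

lemma dense_thin_image_maps:
  fixes \<Omega> :: "'a::euclidean_space set"
  assumes K: "compact K" "K \<subseteq> \<Omega>"
    and W: "openin (continuous_function_space \<Omega>) W" "W \<noteq> {}"
  shows "W \<inter> thin_image_maps \<Omega> K n \<noteq> {}"
proof -
  obtain f where f: "f \<in> W"
    using W(2) by auto
  then have fC: "continuous_on \<Omega> f"
    using openin_subset[OF W(1)] by (auto simp: continuous_maps_def)
  obtain L \<delta> where L: "L \<subseteq> \<Omega>" "\<delta> > 0"
    "\<And>g. g \<in> continuous_maps (top_of_set \<Omega>) euclideanreal \<Longrightarrow> (\<forall>x\<in>L. dist (g x) (f x) < \<delta>) \<Longrightarrow> g \<in> W"
    using compact_open_topology_uniform_nbhd[OF W(1) f] by blast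
  obtain g U Y where g: "continuous_on \<Omega> g" "\<And>x. x \<in> \<Omega> \<Longrightarrow> dist (g x) (f x) < \<delta>"
    "thin_union n U" "thin_union n Y" "g ` (K - U) \<subseteq> Y"
    using thin_image_approximation[OF fC K L(2)] by metis
  \<comment> \<open>Points of the function space are undefined off \<Omega>, so the approximant has
    to be restricted.\<close>
  let ?g = "restrict g \<Omega>"
  have "continuous_on \<Omega> ?g"
    using g(1) by (rule continuous_on_eq) auto
  then have gC: "?g \<in> continuous_maps (top_of_set \<Omega>) euclideanreal"
    by (simp add: continuous_maps_def)
  then have "?g \<in> W"
    using L g(2) by (auto intro!: L(3))
  moreover have "?g ` (K - U) \<subseteq> Y"
    using g(5) K(2) by force
  then have "?g \<in> thin_image_maps \<Omega> K n"
    unfolding thin_image_maps_def using gC g(3,4) by blast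
  ultimately show ?thesis
    by blast
qed

section \<open>The exceptional set of a typical function\<close>

theorem theorem7p7:
  fixes \<Omega> :: "(real ^ 'n) set"
  assumes "locally compact \<Omega>"
  shows "typical (continuous_function_space \<Omega>)
           (\<lambda>f. \<exists>A\<subseteq>\<Omega>. microscopic A \<and> microscopic {y. \<not> {x\<in>\<Omega>. f x = y} \<subseteq> A})"
proof -
  obtain K where K: "\<And>n. compact (K n)" "incseq K" "(\<Union>n. K n) = \<Omega>"
    using locally_compact_exhaustion[OF assms] by metis
  then have K\<Omega>: "K n \<subseteq> \<Omega>" for n
    by blast
  \<comment> \<open>One index serves for both the compact set and the thinness. Nothing is lost, as
    each point of \<Omega> lies in \<open>K n\<close> for all large \<open>n\<close>.\<close>
  have "comeager_in (continuous_function_space \<Omega>) (\<Inter>n. thin_image_maps \<Omega> (K n) n)"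
    by (intro comeager_in_INT_open_dense openin_thin_image_maps dense_thin_image_maps K K\<Omega>)
  moreover have "\<exists>A\<subseteq>\<Omega>. microscopic A \<and> microscopic {y. \<not> {x\<in>\<Omega>. f x = y} \<subseteq> A}"
    if "f \<in> (\<Inter>n. thin_image_maps \<Omega> (K n) n)" for f
  proof -
    have "\<forall>n. \<exists>U Y. thin_union n U \<and> thin_union n Y \<and> f ` (K n - U) \<subseteq> Y"
      using that by (auto simp: thin_image_maps_def)
    then obtain U Y where UY: "\<And>n. thin_union n (U n)" "\<And>n. thin_union n (Y n)"
      "\<And>n. f ` (K n - U n) \<subseteq> Y n"
      by metis
    define A where "A = {x \<in> \<Omega>. \<exists>\<^sub>\<infinity>n. x \<in> U n}"
    have "microscopic A"
      using UY(1) by (rule microscopic_limsup_thin_union) (simp add: A_def)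
    moreover have "microscopic {y. \<not> {x\<in>\<Omega>. f x = y} \<subseteq> A}"
      using UY(2)
    proof (rule microscopic_limsup_thin_union)
      fix y assume "y \<in> {y. \<not> {x\<in>\<Omega>. f x = y} \<subseteq> A}"
      then obtain x where x: "x \<in> \<Omega>" "f x = y" "x \<notin> A"
        by blast
      then obtain N1 where N1: "\<And>n. n \<ge> N1 \<Longrightarrow> x \<notin> U n"
        unfolding A_def INFM_nat_le by blast
      obtain N2 where "x \<in> K N2"
        using x(1) K(3) by blast
      then have N2: "x \<in> K n" if "n \<ge> N2" for n
        using incseqD[OF K(2) that] by blast
      \<comment> \<open>A point outside \<open>A\<close> lies in only finitely many of the sets
        \<open>U n\<close>, so eventually it is in \<open>K n - U n\<close> and its value is in
        \<open>Y n\<close>. This holds for all large \<open>n\<close>, which is more than the upper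
        limit asks for.\<close>
      have y: "y \<in> Y n" if "n \<ge> max N1 N2" for n
        using UY(3)[of n] N1[of n] N2[of n] that x(2) by auto
      show "\<exists>\<^sub>\<infinity>n. y \<in> Y n"
        unfolding INFM_nat_le
      proof
        fix m show "\<exists>n\<ge>m. y \<in> Y n"
          using y[of "max m (max N1 N2)"] by (intro exI[of _ "max m (max N1 N2)"]) simp
      qed
    qed
    ultimately show ?thesis
      unfolding A_def by (intro exI[of _ A]) (auto simp: A_def)
  qed
  ultimately show ?thesis
    unfolding typical_def by blast
qed

end
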